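(* Let $h:\mathbb{R}^n\to\mathbb{R}$ be twice differentiable and strongly quasiconvex with modulus $\gamma>0$, let $\overline{x}$ be its unique minimizer on $\mathbb{R}^n$ and $h^*:=h(\overline{x})$. Let $x_0,v_0\in\mathbb{R}^n$, $\kappa\in\,]0,+\infty[$, $\alpha\in\left]0,\sqrt{\frac{\gamma(\kappa+2)^2}{8\kappa}}\right]$ and $\beta\in\left]0,\frac{\kappa+2}{\kappa\alpha}\right]$, and consider the system $$\ddot{x}(t)+\alpha\dot{x}(t)+\beta\nabla^2h(x(t))\dot{x}(t)+\nabla h(x(t))=0\ (t>0),\qquad x(0)=x_0,\ \dot{x}(0)=v_0.$$ Suppose that every trajectory $x(\cdot)$ of this system satisfies $$\langle\nabla h(x(t)),x(t)-\overline{x}\rangle\ \ge\ \kappa\,(h(x(t))-h(\overline{x}))\quad\text{for all } t\ge 0.$$ Let $x(\cdot)$ be a solution of the system on $[0,+\infty[$. Then, for all $t\ge 0$, $$\frac{\gamma}{4}\|x(t)-\overline{x}\|^2\ \le\ h(x(t))-h^*\ \le\ \mathcal{C}\,e^{-\frac{\lambda\kappa}{2}t},$$ where $\lambda:=\frac{2\alpha}{\kappa+2}$ and $$\mathcal{C}:=h(x_0)-h^*+\frac12\|\lambda(x_0-\overline{x})+v_0+\beta\nabla h(x_0)\|^2.$$ Consequently, the trajectory $x(t)$ converges exponentially to $\overline{x}$, the unique solution of $\min_{x\in\mathbb{R}^n}h(x)$, and the function values $h(x(t))$ converge exponentially to the optimal value $h^*$.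
   Context: $\langle\cdot,\cdot\rangle$ and $\|\cdot\|$ are the Euclidean inner product and norm on $\mathbb{R}^n$. A function $h:\mathbb{R}^n\to\mathbb{R}$ is strongly quasiconvex with modulus $\gamma>0$ if for all $x,y\in\mathbb{R}^n$ and $\lambda\in[0,1]$, $$h(\lambda y+(1-\lambda)x)\le\max\{h(y),h(x)\}-\lambda(1-\lambda)\frac{\gamma}{2}\|x-y\|^2.$$ It is known that a lower semicontinuous strongly quasiconvex function on $\mathbb{R}^n$ has exactly one minimizer $\overline{x}$, and that it satisfies $h(\overline{x})+\frac{\gamma}{4}\|x-\overline{x}\|^2\le h(x)$ for all $x\in\mathbb{R}^n$. *)

theory Defs
  imports "HOL-Analysis.Analysis"
begin

definition gradient :: "(real^'n \<Rightarrow> real) \<Rightarrow> real^'n \<Rightarrow> real^'n" where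
  "gradient h x = (THE D. GDERIV h x :> D)"

definition hessian :: "(real^'n \<Rightarrow> real) \<Rightarrow> real^'n \<Rightarrow> real^'n^'n" where
  "hessian h x = jacobian (gradient h) (at x)"

definition twice_differentiable :: "(real^'n \<Rightarrow> real) \<Rightarrow> bool" where
  "twice_differentiable h \<longleftrightarrow>
     (\<forall>x. h differentiable (at x)) \<and> (\<forall>x. gradient h differentiable (at x))"

definition strongly_quasiconvex :: "real \<Rightarrow> (real^'n \<Rightarrow> real) \<Rightarrow> bool" where
  "strongly_quasiconvex \<gamma> h \<longleftrightarrow>
     \<gamma> > 0 \<and>
     (\<forall>x y. \<forall>\<theta>\<in>{0..1}.
        h (\<theta> *\<^sub>R y + (1 - \<theta>) *\<^sub>R x)
          \<le> max (h y) (h x) - \<theta> * (1 - \<theta>) * (\<gamma> / 2) * (norm (x - y))\<^sup>2)"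

(* Solutions on [0,+oo[ are C^1 up to t = 0 (one-sided derivative there) and twice
   differentiable for t > 0. The acceleration is not required to be continuous, since
   the Hessian of h need not be. *)
definition is_trajectory ::
  "(real^'n \<Rightarrow> real) \<Rightarrow> real \<Rightarrow> real \<Rightarrow> real^'n \<Rightarrow> real^'n \<Rightarrow> (real \<Rightarrow> real^'n) \<Rightarrow> bool" where
  "is_trajectory h \<alpha> \<beta> x0 v0 x \<longleftrightarrow>
     (\<exists>v a.
        (\<forall>t\<ge>0. (x has_vector_derivative v t) (at t within {0..})) \<and>
        continuous_on {0..} v \<and>
        (\<forall>t>0. (v has_vector_derivative a t) (at t)) \<and>
        (\<forall>t>0. a t + \<alpha> *\<^sub>R v t + \<beta> *\<^sub>R (hessian h (x t) *v v t) + gradient h (x t) = 0) \<and>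
        x 0 = x0 \<and> v 0 = v0)"

definition converges_exponentially :: "(real \<Rightarrow> 'a::metric_space) \<Rightarrow> 'a \<Rightarrow> bool" where
  "converges_exponentially f l \<longleftrightarrow>
     (\<exists>M r. r > 0 \<and> (\<forall>t\<ge>0. dist (f t) l \<le> M * exp (- r * t)))"

lemma gradient_eqI:
  assumes "GDERIV h x :> D"
  shows "gradient h x = D"
  unfolding gradient_def
proof (rule the_equality)
  show "GDERIV h x :> D" by (fact assms)
next
  fix E assume "GDERIV h x :> E"
  with assms have "(\<lambda>k. k \<bullet> E) = (\<lambda>k. k \<bullet> D)"
    unfolding gderiv_def by (metis has_derivative_unique)
  then show "E = D"
    by (metis vector_eq_ldot)
qed

lemma GDERIV_gradient:
  assumes "h differentiable (at x)"
  shows "GDERIV h x :> gradient h x"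
proof -
  obtain F where F: "(h has_derivative F) (at x)"
    using assms by (auto simp: differentiable_def)
  then have "linear F"
    by (rule has_derivative_linear)
  then have "F = (\<lambda>k. k \<bullet> adjoint F 1)"
    using adjoint_works[of F _ 1] by (auto simp: fun_eq_iff inner_commute)
  with F have "GDERIV h x :> adjoint F 1"
    by (simp add: gderiv_def)
  then show ?thesis
    using gradient_eqI by metis
qed

lemma has_derivative_gradient_hessian:
  "gradient h differentiable (at x) \<Longrightarrow> (gradient h has_derivative (\<lambda>k. hessian h x *v k)) (at x)"
  unfolding hessian_def by (simp flip: jacobian_works)

end

theory Submission
  imports Defs
begin

text \<open>
  The trajectory is controlled by the energy \<open>E = h x - h xbar + \<parallel>w\<parallel>\<^sup>2 / 2\<close>, where
  \<open>w = lam (x - xbar) + x' + \<beta> \<nabla>h x\<close>. The velocity \<open>x'\<close> and the gradient are combined in \<open>w\<close>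
  because the Hessian term of the equation is exactly the derivative of \<open>\<beta> \<nabla>h x\<close>: hence
  \<open>w' = (lam - \<alpha>) x' - \<nabla>h x\<close> involves no second-order quantity, and
  \<open>lam - \<alpha> = - lam \<kappa> / 2\<close> by the choice of \<open>lam\<close>. The theorem follows from
  \<open>E' \<le> - (lam \<kappa> / 2) E\<close>, since \<open>E 0 = C\<close> and \<open>h x - h xbar \<le> E\<close>.

  This differential inequality is pure inner product algebra in \<open>d = x - xbar\<close>, \<open>x'\<close> and
  \<open>g = \<nabla>h x\<close> (\<open>energy_dissipation\<close>). It rests on two lower bounds for \<open>g \<bullet> d\<close>: the one by
  \<open>\<kappa> (h x - h xbar)\<close> that is assumed along the trajectory, and the first-order form
  \<open>g \<bullet> d \<ge> \<gamma> / 2 \<parallel>d\<parallel>\<^sup>2\<close> of strong quasiconvexity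
  (\<open>strongly_quasiconvex_gradient\<close>). Through the Cauchy--Schwarz inequality the latter also
  gives \<open>\<parallel>g\<parallel>\<^sup>2 \<ge> \<gamma> / 2 (g \<bullet> d)\<close>, and so the term \<open>- \<beta> \<parallel>g\<parallel>\<^sup>2\<close> of \<open>E'\<close>
  compensates for the dissipation that a large \<open>\<beta>\<close> takes away from \<open>g \<bullet> d\<close>. In terms of
  \<open>lam\<close>, the upper bound on \<open>\<alpha>\<close> says \<open>2 \<kappa> lam\<^sup>2 \<le> \<gamma>\<close>, which keeps the term
  in \<open>\<parallel>d\<parallel>\<^sup>2\<close> small against \<open>g \<bullet> d\<close>, and the upper bound on \<open>\<beta>\<close> says
  \<open>lam \<kappa> / 2 * \<beta> \<le> 1\<close>, which keeps the coefficient of \<open>g \<bullet> d\<close> from changing sign.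

  Integrating the first-order inequality along the segment from the minimizer gives quadratic
  growth with constant \<open>\<gamma> / 4\<close> (\<open>strongly_quasiconvex_quadratic_growth\<close>). This yields the
  lower bound of the theorem, uniqueness of the minimizer, and the passage from decay of the values
  to decay of the distance.
\<close>

section \<open>Differentiable strongly quasiconvex functions\<close>

lemma gradient_chain_rule:
  assumes "h differentiable (at (x t))" and "(x has_vector_derivative v) (at t)"
  shows "((\<lambda>s. h (x s)) has_real_derivative gradient h (x t) \<bullet> v) (at t)"
proof -
  have "(h has_derivative (\<lambda>k. k \<bullet> gradient h (x t))) (at (x t))"
    using GDERIV_gradient[OF assms(1)] by (simp add: gderiv_def)
  from has_derivative_compose[OF assms(2)[unfolded has_vector_derivative_def] this]
  show ?thesis
    by (simp add: has_field_derivative_def inner_commute mult_commute_abs)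
qed

text \<open>
  The defining inequality bounds \<open>h (y + \<theta> (z - y))\<close>, plus its quadratic term in \<open>\<theta>\<close>, by the
  value \<open>h y\<close> that this expression takes at \<open>\<theta> = 0\<close>; hence its derivative at \<open>\<theta> = 0\<close> cannot
  be positive.
\<close>
lemma strongly_quasiconvex_gradient:
  assumes sqc: "strongly_quasiconvex \<gamma> h" and diff: "h differentiable (at y)" and "h z \<le> h y"
  shows "\<gamma> / 2 * (norm (y - z))\<^sup>2 \<le> gradient h y \<bullet> (y - z)"
proof (rule ccontr)
  let ?N = "\<gamma> / 2 * (norm (y - z))\<^sup>2"
  let ?\<psi> = "\<lambda>\<theta>. h (y + \<theta> *\<^sub>R (z - y)) + (\<theta> - \<theta>\<^sup>2) * ?N"
  assume "\<not> ?thesis"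
  then have pos: "0 < gradient h y \<bullet> (z - y) + ?N"
    by (simp add: inner_diff_right)
  have "((\<lambda>\<theta>. y + \<theta> *\<^sub>R (z - y)) has_vector_derivative (z - y)) (at 0)"
    by (auto intro!: derivative_eq_intros)
  from gradient_chain_rule[OF _ this, of h] diff
  have "((\<lambda>\<theta>. h (y + \<theta> *\<^sub>R (z - y))) has_real_derivative gradient h y \<bullet> (z - y)) (at 0)"
    by simp
  moreover have "((\<lambda>\<theta>. (\<theta> - \<theta>\<^sup>2) * ?N) has_real_derivative ?N) (at 0)"
    by (auto intro!: derivative_eq_intros)
  ultimately have "(?\<psi> has_real_derivative gradient h y \<bullet> (z - y) + ?N) (at 0)"
    by (rule DERIV_add)
  from DERIV_pos_inc_right[OF this pos] obtain \<delta>
    where \<delta>: "\<delta> > 0" "\<And>\<theta>. 0 < \<theta> \<Longrightarrow> \<theta> < \<delta> \<Longrightarrow> ?\<psi> 0 < ?\<psi> \<theta>"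
    by auto
  define \<theta> where "\<theta> = min 1 (\<delta> / 2)"
  have \<theta>: "0 < \<theta>" "\<theta> < \<delta>" "\<theta> \<le> 1"
    using \<delta>(1) by (auto simp: \<theta>_def)
  have "h (\<theta> *\<^sub>R z + (1 - \<theta>) *\<^sub>R y) \<le> max (h z) (h y) - \<theta> * (1 - \<theta>) * ?N"
    using sqc \<theta> unfolding strongly_quasiconvex_def by (simp add: mult.assoc)
  moreover have "\<theta> *\<^sub>R z + (1 - \<theta>) *\<^sub>R y = y + \<theta> *\<^sub>R (z - y)"
    by (simp add: algebra_simps)
  ultimately have "?\<psi> \<theta> \<le> h y"
    using \<open>h z \<le> h y\<close> by (simp add: algebra_simps power2_eq_square)
  with \<delta>(2)[OF \<theta>(1,2)] show False
    by simp
qed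

text \<open>
  The constant \<open>\<gamma> / 4\<close> comes from integrating the first-order inequality along the segment from
  \<open>z\<close> to \<open>y\<close>: at the point \<open>z + s (y - z)\<close> the slope is at least \<open>\<gamma> / 2 \<parallel>y - z\<parallel>\<^sup>2 s\<close>. The
  defining inequality at the midpoint of the segment would give only \<open>\<gamma> / 8\<close>.
\<close>
lemma strongly_quasiconvex_quadratic_growth:
  assumes sqc: "strongly_quasiconvex \<gamma> h" and diff: "\<And>y. h differentiable (at y)"
    and min: "\<And>y. h z \<le> h y"
  shows "h z + \<gamma> / 4 * (norm (y - z))\<^sup>2 \<le> h y"
proof -
  let ?p = "\<lambda>s. z + s *\<^sub>R (y - z)"
  let ?\<phi> = "\<lambda>s. h (?p s) - s\<^sup>2 * (\<gamma> / 4 * (norm (y - z))\<^sup>2)"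
  let ?\<phi>' = "\<lambda>s. gradient h (?p s) \<bullet> (y - z) - s * (\<gamma> / 2 * (norm (y - z))\<^sup>2)"
  have deriv: "(?\<phi> has_real_derivative ?\<phi>' s) (at s)" for s
  proof (rule DERIV_diff)
    have "(?p has_vector_derivative (y - z)) (at s)"
      by (auto intro!: derivative_eq_intros)
    from gradient_chain_rule[OF _ this] diff
    show "((\<lambda>s. h (?p s)) has_real_derivative gradient h (?p s) \<bullet> (y - z)) (at s)"
      by blast
  qed (auto intro!: derivative_eq_intros)
  have nonneg: "0 \<le> ?\<phi>' s" if "0 < s" for s
  proof -
    have "\<gamma> / 2 * (norm (?p s - z))\<^sup>2 \<le> gradient h (?p s) \<bullet> (?p s - z)"
      by (rule strongly_quasiconvex_gradient[OF sqc diff min])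
    then have "s * (s * (\<gamma> / 2 * (norm (y - z))\<^sup>2)) \<le> s * (gradient h (?p s) \<bullet> (y - z))"
      by (simp add: power2_eq_square ac_simps)
    with that show ?thesis
      by simp
  qed
  have "?\<phi> 0 \<le> ?\<phi> 1"
  proof (rule DERIV_nonneg_imp_increasing_open[of 0 1 ?\<phi>])
    show "\<exists>l. (?\<phi> has_real_derivative l) (at s) \<and> 0 \<le> l" if "0 < s" for s
      using deriv[of s] nonneg[OF that] by blast
    show "continuous_on {0..1} ?\<phi>"
      by (rule DERIV_continuous_on[OF has_field_derivative_at_within[OF deriv]])
  qed simp
  then show ?thesis
    by simp
qed

section \<open>Energy decay\<close>

text \<open>
  A differential inequality on the open half-line is enough, since the energy is only known to be
  differentiable for positive times.
\<close>
lemma exponential_decay_of_differential_inequality: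
  fixes E E' :: "real \<Rightarrow> real"
  assumes cont: "continuous_on {0..} E"
    and deriv: "\<And>t. t > 0 \<Longrightarrow> (E has_real_derivative E' t) (at t)"
    and le: "\<And>t. t > 0 \<Longrightarrow> E' t \<le> - c * E t"
    and "t \<ge> 0"
  shows "E t \<le> E 0 * exp (- c * t)"
proof -
  let ?F = "\<lambda>s. E s * exp (c * s)"
  have "?F t \<le> ?F 0"
  proof (rule DERIV_nonpos_imp_decreasing_open[OF \<open>t \<ge> 0\<close>])
    fix s assume "0 < s" "s < t"
    have "(?F has_real_derivative (E' s + c * E s) * exp (c * s)) (at s)"
      by (auto intro!: derivative_eq_intros deriv[OF \<open>0 < s\<close>] simp: algebra_simps)
    moreover have "(E' s + c * E s) * exp (c * s) \<le> 0"
      using le[OF \<open>0 < s\<close>] by (simp add: mult_le_0_iff)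
    ultimately show "\<exists>y. (?F has_real_derivative y) (at s) \<and> y \<le> 0"
      by blast
  next
    show "continuous_on {0..t} ?F"
      by (intro continuous_intros continuous_on_subset[OF cont]) auto
  qed
  then have "?F t * exp (- c * t) \<le> E 0 * exp (- c * t)"
    by simp
  then show ?thesis
    by (simp add: mult.assoc flip: exp_add)
qed

text \<open>
  Here \<open>d\<close>, \<open>v\<close>, \<open>g\<close> and \<open>f\<close> stand for the displacement from the minimizer, the velocity, the
  gradient and the excess value; the left-hand side is then the derivative of the energy. Put
  \<open>b = c \<beta> \<le> 1\<close>. Expanding the squares, the claim becomes nonnegativity of
  \<open>lam (1 - b) (g \<bullet> d) + \<beta> (1 - b / 2) \<parallel>g\<parallel>\<^sup>2 - c f - c lam\<^sup>2 / 2 \<parallel>d\<parallel>\<^sup>2 + c / 2 \<parallel>v\<parallel>\<^sup>2\<close>. Each of the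
  first four terms is bounded below by a multiple of \<open>lam (g \<bullet> d)\<close>, with factors \<open>1 - b\<close>,
  \<open>2 b - b\<^sup>2\<close>, \<open>- 1 / 2\<close> and \<open>- 1 / 4\<close> respectively, and these add up to
  \<open>1 / 4 + b (1 - b) > 0\<close>.
\<close>
lemma energy_dissipation:
  fixes d v g :: "'a::real_inner" and lam \<kappa> \<beta> \<gamma> f :: real
  defines "c \<equiv> lam * \<kappa> / 2"
  defines "w \<equiv> lam *\<^sub>R d + v + \<beta> *\<^sub>R g"
  assumes pos: "lam > 0" "\<kappa> > 0" "\<beta> > 0"
    and lam: "2 * \<kappa> * lam\<^sup>2 \<le> \<gamma>" and \<beta>: "c * \<beta> \<le> 1"
    and value_bound: "\<kappa> * f \<le> g \<bullet> d"
    and dist_bound: "\<gamma> / 2 * (norm d)\<^sup>2 \<le> g \<bullet> d"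
  shows "g \<bullet> v + w \<bullet> (- c *\<^sub>R v - g) \<le> - c * (f + 1/2 * (norm w)\<^sup>2)"
proof -
  define P D G V where "P = g \<bullet> d" and "D = d \<bullet> d" and "G = g \<bullet> g" and "V = v \<bullet> v"
  define b where "b = c * \<beta>"
  have "c > 0"
    using pos by (simp add: c_def)
  have b: "0 \<le> b" "b \<le> 1"
    using \<beta> \<open>c > 0\<close> pos by (auto simp: b_def)
  have "\<gamma> > 0"
    using lam pos by (smt (verit) mult_pos_pos zero_less_power)
  have DP: "\<gamma> / 2 * D \<le> P"
    using dist_bound by (simp add: D_def P_def power2_norm_eq_inner)
  have nonneg: "D \<ge> 0" "G \<ge> 0" "V \<ge> 0"
    by (simp_all add: D_def G_def V_def)
  have "P \<ge> 0"
    using DP \<open>\<gamma> > 0\<close> nonneg by (smt (verit) divide_pos_pos mult_nonneg_nonneg)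
  \<comment> \<open>Cauchy--Schwarz gives \<open>P\<^sup>2 \<le> G D\<close>; the bound \<open>\<gamma> / 2 D \<le> P\<close> trades one factor \<open>P\<close> for \<open>D\<close>.\<close>
  have PG: "\<gamma> / 2 * P \<le> G"
  proof (cases "D = 0")
    case True
    then show ?thesis
      by (simp add: P_def D_def G_def)
  next
    case False
    have "(\<gamma> / 2 * P) * D \<le> P * P"
      using mult_left_mono[OF DP \<open>P \<ge> 0\<close>] by (simp add: ac_simps)
    also have "\<dots> \<le> G * D"
      using Cauchy_Schwarz_ineq[of g d] by (simp add: P_def G_def D_def power2_eq_square)
    finally show ?thesis
      using False nonneg by simp
  qed
  have "c * f \<le> lam / 2 * P"
    using mult_left_mono[OF value_bound, of "lam / 2"] pos
    by (simp add: c_def P_def mult.assoc)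
  moreover have "c * lam\<^sup>2 / 2 * D \<le> lam / 4 * P"
  proof -
    have "c * lam\<^sup>2 / 2 * D = lam / 8 * ((2 * \<kappa> * lam\<^sup>2) * D)"
      by (simp add: c_def)
    also have "\<dots> \<le> lam / 8 * (\<gamma> * D)"
      using lam nonneg pos by (intro mult_left_mono mult_right_mono) auto
    also have "\<dots> \<le> lam / 8 * (2 * P)"
      using DP pos by (intro mult_left_mono) auto
    finally show ?thesis
      by (simp add: mult.commute)
  qed
  moreover have "lam * (2 * b - b\<^sup>2) * P \<le> \<beta> * (1 - b / 2) * G"
  proof -
    have "lam * (2 * b - b\<^sup>2) * P = (2 * b) * lam * (1 - b / 2) * P"
      by (simp add: algebra_simps power2_eq_square)
    also have "\<dots> = (\<kappa> * lam * \<beta>) * lam * (1 - b / 2) * P"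
      by (simp add: b_def c_def)
    also have "\<dots> = \<beta> * (1 - b / 2) * ((2 * \<kappa> * lam\<^sup>2) / 2 * P)"
      by (simp add: power2_eq_square)
    also have "\<dots> \<le> \<beta> * (1 - b / 2) * (\<gamma> / 2 * P)"
      using lam \<open>P \<ge> 0\<close> b pos by (intro mult_left_mono mult_right_mono divide_right_mono) auto
    also have "\<dots> \<le> \<beta> * (1 - b / 2) * G"
      using PG b pos by (intro mult_left_mono) auto
    finally show ?thesis .
  qed
  moreover have "0 \<le> lam * (1 / 4 + b * (1 - b)) * P"
    using b pos \<open>P \<ge> 0\<close> by simp
  moreover have "lam * (1 / 4 + b * (1 - b)) * P
      = lam * (1 - b) * P + lam * (2 * b - b\<^sup>2) * P - lam / 2 * P - lam / 4 * P"
    by (simp add: algebra_simps power2_eq_square)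
  moreover have "0 \<le> c / 2 * V"
    using \<open>c > 0\<close> nonneg by simp
  moreover have "g \<bullet> v + w \<bullet> (- c *\<^sub>R v - g) + c * (f + 1/2 * (norm w)\<^sup>2)
      = c * f + c * lam\<^sup>2 / 2 * D - lam * (1 - b) * P - \<beta> * (1 - b / 2) * G - c / 2 * V"
    unfolding w_def b_def P_def D_def G_def V_def power2_norm_eq_inner
    by (simp add: inner_commute[of v d] inner_commute[of v g] inner_commute[of d g]
        algebra_simps power2_eq_square)
  ultimately show ?thesis
    by linarith
qed

section \<open>Exponential convergence of trajectories\<close>

theorem theorem5:
  fixes h :: "real^'n \<Rightarrow> real"
    and \<gamma> \<kappa> \<alpha> \<beta> lam C :: real
    and xbar x0 v0 :: "real^'n"
    and x :: "real \<Rightarrow> real^'n"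
  assumes "twice_differentiable h"
    and "\<gamma> > 0"
    and "strongly_quasiconvex \<gamma> h"
    and "is_arg_min h (\<lambda>_. True) xbar"
    and "\<kappa> > 0"
    and "\<alpha> \<in> {0<..sqrt (\<gamma> * (\<kappa> + 2)\<^sup>2 / (8 * \<kappa>))}"
    and "\<beta> \<in> {0<..(\<kappa> + 2) / (\<kappa> * \<alpha>)}"
    and "\<And>y. is_trajectory h \<alpha> \<beta> x0 v0 y \<Longrightarrow>
           \<forall>t\<ge>0. gradient h (y t) \<bullet> (y t - xbar) \<ge> \<kappa> * (h (y t) - h xbar)"
    and "is_trajectory h \<alpha> \<beta> x0 v0 x"
    and "lam = 2 * \<alpha> / (\<kappa> + 2)"
    and "C = h x0 - h xbar + (1/2) * (norm (lam *\<^sub>R (x0 - xbar) + v0 + \<beta> *\<^sub>R gradient h x0))\<^sup>2"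
  shows "(\<forall>t\<ge>0. \<gamma> / 4 * (norm (x t - xbar))\<^sup>2 \<le> h (x t) - h xbar \<and>
                 h (x t) - h xbar \<le> C * exp (- (lam * \<kappa> / 2) * t)) \<and>
         (\<forall>z. is_arg_min h (\<lambda>_. True) z \<longleftrightarrow> z = xbar) \<and>
         converges_exponentially x xbar \<and>
         converges_exponentially (\<lambda>t. h (x t)) (h xbar)"
proof -
  define c where "c = lam * \<kappa> / 2"
  have diff: "h differentiable (at y)" and grad_diff: "gradient h differentiable (at y)" for y
    using assms(1) by (auto simp: twice_differentiable_def)
  have min: "h xbar \<le> h y" for y
    using assms(4) by (auto simp: is_arg_min_def not_less)
  note growth = strongly_quasiconvex_quadratic_growth[OF assms(3) diff min]
  have pos: "\<gamma> > 0" "\<kappa> > 0" "\<alpha> > 0" "\<beta> > 0"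
    using assms by auto
  have "lam > 0"
    using assms(10) pos by simp
  then have "c > 0"
    using pos by (simp add: c_def)
  have "\<alpha>\<^sup>2 \<le> \<gamma> * (\<kappa> + 2)\<^sup>2 / (8 * \<kappa>)"
    using assms(6) pos by (intro sqrt_ge_absD) auto
  then have lam: "2 * \<kappa> * lam\<^sup>2 \<le> \<gamma>"
    using pos by (simp add: assms(10) field_simps)
  have \<beta>: "c * \<beta> \<le> 1"
    using assms(7) pos by (simp add: c_def assms(10) field_simps)
  have \<alpha>: "lam - \<alpha> = - c"
    using pos by (simp add: c_def assms(10) field_simps)

  obtain v a where traj: "\<forall>t\<ge>0. (x has_vector_derivative v t) (at t within {0..})"
      "\<forall>t>0. (v has_vector_derivative a t) (at t)"
      "\<forall>t>0. a t + \<alpha> *\<^sub>R v t + \<beta> *\<^sub>R (hessian h (x t) *v v t) + gradient h (x t) = 0"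
    and v_cont: "continuous_on {0..} v" and init: "x 0 = x0" "v 0 = v0"
    using assms(9) unfolding is_trajectory_def by (elim exE conjE) (rule that)
  note x_deriv = traj(1)[rule_format] and v_deriv = traj(2)[rule_format]
    and eq = traj(3)[rule_format]
  have x_deriv': "(x has_vector_derivative v t) (at t)" if "t > 0" for t
    using x_deriv[of t] that by (simp add: at_within_interior[of t "{0..}"])
  have x_cont: "continuous_on {0..} x"
    unfolding continuous_on_eq_continuous_within
    using x_deriv has_vector_derivative_continuous by fastforce

  define w where "w t = lam *\<^sub>R (x t - xbar) + v t + \<beta> *\<^sub>R gradient h (x t)" for t
  define E where "E t = h (x t) - h xbar + 1/2 * (norm (w t))\<^sup>2" for t
  have w_deriv: "(w has_vector_derivative (- c *\<^sub>R v t - gradient h (x t))) (at t)"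
    if "t > 0" for t
  proof -
    have "((\<lambda>s. gradient h (x s)) has_vector_derivative hessian h (x t) *v v t) (at t)"
      using has_derivative_compose[OF x_deriv'[OF that, unfolded has_vector_derivative_def]
          has_derivative_gradient_hessian[OF grad_diff]]
      by (simp add: has_vector_derivative_def matrix_vector_mult_scaleR)
    then have "(w has_vector_derivative
        (lam *\<^sub>R v t + a t + \<beta> *\<^sub>R (hessian h (x t) *v v t))) (at t)"
      unfolding w_def by (auto intro!: derivative_eq_intros x_deriv' v_deriv that)
    \<comment> \<open>The equation of motion eliminates the acceleration together with the Hessian term.\<close>
    moreover have "lam *\<^sub>R v t + a t + \<beta> *\<^sub>R (hessian h (x t) *v v t)
        = (lam - \<alpha>) *\<^sub>R v t - gradient h (x t)"
      using eq[OF that] by (simp add: algebra_simps eq_neg_iff_add_eq_0)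
    ultimately show ?thesis
      by (simp add: \<alpha>)
  qed
  define E' where
    "E' t = gradient h (x t) \<bullet> v t + w t \<bullet> (- c *\<^sub>R v t - gradient h (x t))" for t
  have E_deriv: "(E has_real_derivative E' t) (at t)" if "t > 0" for t
  proof -
    let ?w' = "- c *\<^sub>R v t - gradient h (x t)"
    have "((\<lambda>s. w s \<bullet> w s) has_real_derivative 2 * (w t \<bullet> ?w')) (at t)"
      using bounded_bilinear.has_vector_derivative[OF bounded_bilinear_inner
          w_deriv[OF that] w_deriv[OF that]]
      by (simp only: has_real_derivative_iff_has_vector_derivative inner_commute mult_2)
    from DERIV_cmult[OF this, of "1/2"]
    have "((\<lambda>s. 1/2 * (w s \<bullet> w s)) has_real_derivative w t \<bullet> ?w') (at t)"
      by (simp only: mult.assoc[symmetric]) simp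
    from DERIV_add[OF DERIV_diff[OF gradient_chain_rule[OF diff x_deriv'[OF that]]
        DERIV_const[of "h xbar"]] this]
    show ?thesis
      by (simp add: E_def[abs_def] E'_def power2_norm_eq_inner)
  qed
  have E_dissipation: "E' t \<le> - c * E t" if "t > 0" for t
    unfolding E'_def E_def w_def c_def
  proof (rule energy_dissipation[OF \<open>lam > 0\<close> pos(2,4) lam])
    show "lam * \<kappa> / 2 * \<beta> \<le> 1"
      using \<beta> by (simp add: c_def)
    show "\<kappa> * (h (x t) - h xbar) \<le> gradient h (x t) \<bullet> (x t - xbar)"
      using assms(8)[OF assms(9)] that by simp
    show "\<gamma> / 2 * (norm (x t - xbar))\<^sup>2 \<le> gradient h (x t) \<bullet> (x t - xbar)"
      by (rule strongly_quasiconvex_gradient[OF assms(3) diff min])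
  qed
  have E_cont: "continuous_on {0..} E"
  proof -
    have "continuous_on UNIV h" "continuous_on UNIV (gradient h)"
      using diff grad_diff
      by (auto simp: continuous_on_eq_continuous_at differentiable_imp_continuous_within)
    then have "continuous_on {0..} (\<lambda>t. h (x t))" "continuous_on {0..} (\<lambda>t. gradient h (x t))"
      by (auto intro: continuous_on_compose2[OF _ x_cont])
    then show ?thesis
      unfolding E_def w_def by (intro continuous_intros x_cont v_cont)
  qed
  have "E 0 = C"
    by (simp add: E_def w_def init assms(11))
  have upper: "h (x t) - h xbar \<le> C * exp (- c * t)" if "t \<ge> 0" for t
  proof -
    have "h (x t) - h xbar \<le> E t"
      by (simp add: E_def)
    also have "\<dots> \<le> E 0 * exp (- c * t)"
      by (rule exponential_decay_of_differential_inequality[OF E_cont E_deriv E_dissipation that])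
    finally show ?thesis
      by (simp add: \<open>E 0 = C\<close>)
  qed
  have lower: "\<gamma> / 4 * (norm (y - xbar))\<^sup>2 \<le> h y - h xbar" for y
    using growth[of y] by simp

  have "is_arg_min h (\<lambda>_. True) z \<longleftrightarrow> z = xbar" for z
  proof
    assume "is_arg_min h (\<lambda>_. True) z"
    then have "h z \<le> h xbar"
      by (auto simp: is_arg_min_def not_less)
    then have "\<gamma> / 4 * (norm (z - xbar))\<^sup>2 \<le> 0"
      using lower[of z] by linarith
    then show "z = xbar"
      using pos by (simp add: mult_le_0_iff)
  qed (use assms(4) in simp)
  moreover have "converges_exponentially (\<lambda>t. h (x t)) (h xbar)"
    unfolding converges_exponentially_def dist_real_def
    using upper min \<open>c > 0\<close> by (intro exI[of _ C] exI[of _ c]) auto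
  moreover have "converges_exponentially x xbar"
    unfolding converges_exponentially_def
  proof (intro exI conjI allI impI)
    show "c / 2 > 0"
      using \<open>c > 0\<close> by simp
    fix t :: real assume "t \<ge> 0"
    have "(dist (x t) xbar)\<^sup>2 \<le> 4 / \<gamma> * (C * exp (- c * t))"
      using lower[of "x t"] upper[OF \<open>t \<ge> 0\<close>] pos by (simp add: dist_norm field_simps)
    then have "dist (x t) xbar \<le> sqrt (4 / \<gamma> * C * exp (- c * t))"
      by (intro real_le_rsqrt) (simp add: mult.assoc)
    also have "exp (- c * t) = (exp (- (c / 2) * t))\<^sup>2"
      by (simp flip: exp_double)
    also have "sqrt (4 / \<gamma> * C * (exp (- (c / 2) * t))\<^sup>2)
        = sqrt (4 / \<gamma> * C) * exp (- (c / 2) * t)"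
      by (simp only: real_sqrt_mult real_sqrt_abs abs_exp_cancel)
    finally show "dist (x t) xbar \<le> sqrt (4 / \<gamma> * C) * exp (- (c / 2) * t)" .
  qed
  ultimately show ?thesis
    using lower upper by (simp add: c_def)
qed

end
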